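(* Let $\mathbb F_q$ be a finite field, let $n\ge 1$, and let $A$ be a symmetric $n\times n$ matrix over $\mathbb F_q$ which is an LPM matrix, i.e. $\Delta_k(A)\neq 0$ for every $1\le k\le n$. Put $$\delta_k(A)=\frac{\Delta_k(A)}{\Delta_{k-1}(A)}\qquad(1\le k\le n).$$ Then $$\nu_q(A)=\prod_{k=1}^n\rho_q\bigl(\delta_k(A)\bigr).$$ Consequently, $$\nu_q(A)=\begin{cases}1,&q\text{ even},\\ 2^n,&q\text{ odd and }\chi(\Delta_k(A))=1\text{ for every }k\in\{1,\dots,n\},\\ 0,&q\text{ odd and }\chi(\Delta_k(A))=-1\text{ for at least one }k\in\{1,\dots,n\}.\end{cases}$$
   Context: For a symmetric $n\times n$ matrix $A$ over $\mathbb F_q$, $\nu_q(A)$ denotes the number of $n\times n$ upper triangular matrices $U$ over $\mathbb F_q$ (not necessarily invertible) with $U^TU=A$. For $a\in\mathbb F_q$, $\rho_q(a)=\#\{u\in\mathbb F_q:u^2=a\}$. $\Delta_k(A)$ is the determinant of the leading principal $k\times k$ submatrix of $A$ (first $k$ rows and columns), and $\Delta_0(A)=1$. For $q$ odd, $\chi$ is the quadratic character of $\mathbb F_q$: $\chi(x)=1$ if $x$ is a nonzero square, $\chi(x)=-1$ if $x$ is a nonsquare, and $\chi(0)=0$. *)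

theory Defs
  imports "HOL-Library.Cardinality" "Jordan_Normal_Form.Determinant" "Jordan_Normal_Form.DL_Submatrix"
begin

text \<open>
  The field \<open>F\<^sub>q\<close> is a type of class field and finite, and q is its cardinality \<open>CARD('a)\<close>.
  Matrix entries are indexed from 0, so the first k rows are those with index in \<open>{..<k}\<close>.
\<close>

definition leading_minor :: "nat \<Rightarrow> 'a :: field mat \<Rightarrow> 'a" where
  "leading_minor k A = det (submatrix A {..<k} {..<k})"

text \<open>Only meaningful for \<open>k \<ge> 1\<close>, since \<open>k - 1\<close> is truncated at 0.\<close>

definition leading_minor_ratio :: "nat \<Rightarrow> 'a :: field mat \<Rightarrow> 'a" where
  "leading_minor_ratio k A = leading_minor k A / leading_minor (k - 1) A"

definition lpm_mat :: "'a :: field mat \<Rightarrow> bool" where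
  "lpm_mat A \<longleftrightarrow> square_mat A \<and> (\<forall>k\<in>{1..dim_row A}. leading_minor k A \<noteq> 0)"

definition symmetric_mat :: "'a mat \<Rightarrow> bool" where
  "symmetric_mat A \<longleftrightarrow> transpose_mat A = A"

definition num_upper_factorizations :: "'a :: {field, finite} mat \<Rightarrow> nat" where
  "num_upper_factorizations A =
     card {U \<in> carrier_mat (dim_row A) (dim_row A).
             upper_triangular U \<and> transpose_mat U * U = A}"

definition num_square_roots :: "'a :: {field, finite} \<Rightarrow> nat" where
  "num_square_roots a = card {u :: 'a. u ^ 2 = a}"

text \<open>This is the quadratic character only when \<open>CARD('a)\<close> is odd.\<close>

definition quadratic_char :: "'a :: {field, finite} \<Rightarrow> int" where
  "quadratic_char x = (if x = 0 then 0 else if \<exists>u. u ^ 2 = x then 1 else -1)"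

lemma leading_minor_0: "leading_minor 0 A = 1"
proof -
  have "submatrix A {..<0} {..<0} \<in> carrier_mat 0 0"
    by (rule carrier_matI) (simp_all add: dim_submatrix)
  then show ?thesis
    unfolding leading_minor_def by (rule det_dim_zero)
qed

lemma pick_lessThan:
  assumes "i < k"
  shows "pick {..<k} i = i"
proof -
  have "{a \<in> {..<k}. a < i} = {..<i}"
    using assms by auto
  then have c: "card {a \<in> {..<k}. a < i} = i"
    by simp
  have "pick {..<k} (card {a \<in> {..<k}. a < i}) = i"
    by (rule pick_card_in_set) (use assms in simp)
  then show ?thesis
    by (simp only: c)
qed

lemma leading_minor_eq_det_mat:
  assumes "A \<in> carrier_mat n n" and "k \<le> n"
  shows "leading_minor k A = det (mat k k (\<lambda>(i, j). A $$ (i, j)))"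
proof -
  have "{i. i < n \<and> i \<in> {..<k}} = {..<k}"
    using assms(2) by auto
  then have c: "card {i. i < n \<and> i \<in> {..<k}} = k"
    by (simp only: card_lessThan)
  have d: "dim_row A = n" "dim_col A = n"
    using assms(1) by (rule carrier_matD)+
  have "submatrix A {..<k} {..<k} = mat k k (\<lambda>(i, j). A $$ (i, j))"
    unfolding submatrix_def d c
    by (rule cong_mat) (simp_all add: pick_lessThan)
  then show ?thesis
    by (simp only: leading_minor_def)
qed

end

theory Submission
  imports Defs "HOL-Library.Disjoint_Sets" "HOL-Library.Z2"
begin

text \<open>
  The factorizations can be counted by bordering, one row and column at a time. Write the matrix of
  size \<open>n + 1\<close> in blocks, \<open>A = (B, b; b\<^sup>T, c)\<close>, where \<open>B\<close> is the leading block of size \<open>n\<close>. An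
  upper triangular \<open>U\<close> of this size is \<open>(V, w; 0, x)\<close> with \<open>V\<close> upper triangular, and \<open>U\<^sup>T U = A\<close>
  means
  \<open>V\<^sup>T V = B\<close>, \<open>V\<^sup>T w = b\<close> and \<open>w\<^sup>T w + x\<^sup>2 = c\<close>.
  Since \<open>(det V)\<^sup>2 = det B\<close> is nonzero, \<open>V\<close> is invertible and determines \<open>w\<close>. Hence the number of
  choices of \<open>x\<close> for a given \<open>V\<close> is the number of square roots of \<open>c - w\<^sup>T w\<close>. Although \<open>w\<close> depends
  on \<open>V\<close>, this number does not: \<open>c - w\<^sup>T w\<close> is the Schur complement of \<open>B\<close> in \<open>A\<close>, which is
  \<open>det A / det B\<close>, the last ratio of leading minors. So passing from \<open>B\<close> to \<open>A\<close> multiplies the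
  count by the number of square roots of this ratio (\<open>card_upper_factors_bordered\<close>), and induction
  on the size gives the product formula (\<open>card_upper_factors_eq_prod\<close>).

  The three special cases only need the number of square roots of a single element. In a finite
  field with an even number of elements squaring is a bijection, so every factor is 1. In one with
  an odd number of elements a nonzero square has two roots. If all leading minors are nonzero
  squares, then so are their ratios, and every factor is 2. Conversely, a leading minor is the
  product of the ratios up to it, so a nonsquare minor forces a nonsquare ratio, and one of the
  factors is 0.
\<close>

section \<open>Square roots in a finite field\<close>

text \<open>
  Counting \<open>X\<close> in the two-element ring cancels each element against its image under the
  involution.
\<close>
lemma even_card_if_fixed_point_free_involution:
  assumes "\<And>x. x \<in> X \<Longrightarrow> h x \<in> X" "\<And>x. x \<in> X \<Longrightarrow> h (h x) = x" "\<And>x. x \<in> X \<Longrightarrow> h x \<noteq> x"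
  shows "even (card X)"
proof -
  have "(\<Sum>x\<in>X. 1 :: bit) = 0"
    by (rule sum_involution_eq_0[of X _ h]) (use assms in auto)
  then have "(of_nat (card X) :: bit) = 0"
    by simp
  moreover have "(of_nat m :: bit) = 0 \<longleftrightarrow> even m" for m
    by (induction m) (auto simp: add_eq_0_iff2)
  ultimately show ?thesis
    by simp
qed

text \<open>
  In characteristic two the translation by 1 is an involution without fixed points. In every other
  characteristic negation has no fixed points apart from 0.
\<close>
lemma even_CARD_iff_two_eq_0: "even CARD('a :: {field, finite}) \<longleftrightarrow> (2 :: 'a) = 0"
proof
  assume even: "even CARD('a)"
  show "(2 :: 'a) = 0"
  proof (rule ccontr)
    assume "(2 :: 'a) \<noteq> 0"
    then have "- x \<noteq> x" if "x \<noteq> 0" for x :: 'a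
      using that by (metis add_eq_0_iff2 mult_2 mult_eq_0_iff)
    then have "even (card (UNIV - {0 :: 'a}))"
      by (intro even_card_if_fixed_point_free_involution[of _ uminus]) auto
    moreover have "Suc (card (UNIV - {0 :: 'a})) = CARD('a)"
      by (rule card_Suc_Diff1) auto
    ultimately show False
      using even by (metis even_Suc)
  qed
next
  assume "(2 :: 'a) = 0"
  then have "x + 1 + 1 = x" for x :: 'a
    by (simp add: add.assoc)
  then show "even CARD('a)"
    by (intro even_card_if_fixed_point_free_involution[of _ "\<lambda>x. x + 1"]) auto
qed

lemma num_square_roots_power2:
  fixes u :: "'a :: {field, finite}"
  shows "num_square_roots (u ^ 2) = card {u, - u}"
proof -
  have "{v. v ^ 2 = u ^ 2} = {u, - u}"
    by (auto simp: power2_eq_iff)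
  then show ?thesis
    by (simp only: num_square_roots_def)
qed

text \<open>
  Here \<open>-u = u\<close>, so squaring is injective, and finiteness makes it surjective.
\<close>
lemma num_square_roots_even_card:
  fixes a :: "'a :: {field, finite}"
  assumes "even CARD('a)"
  shows "num_square_roots a = 1"
proof -
  have neg: "- u = u" for u :: 'a
    using assms even_CARD_iff_two_eq_0[where 'a = 'a]
    by (metis add_eq_0_iff2 mult_2 mult_zero_left)
  have "inj (\<lambda>u :: 'a. u ^ 2)"
    by (rule injI) (metis neg power2_eq_iff)
  then have "surj (\<lambda>u :: 'a. u ^ 2)"
    by (simp add: finite_UNIV_inj_surj)
  then obtain u where "a = u ^ 2"
    by (metis surjD)
  then show ?thesis
    by (simp add: num_square_roots_power2 neg)
qed

lemma num_square_roots_odd_card: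
  fixes u :: "'a :: {field, finite}"
  assumes "odd CARD('a)" and "u \<noteq> 0"
  shows "num_square_roots (u ^ 2) = 2"
proof -
  have "u \<noteq> - u"
    using assms even_CARD_iff_two_eq_0[where 'a = 'a]
    by (metis add_eq_0_iff2 mult_2 mult_eq_0_iff)
  then show ?thesis
    by (simp add: num_square_roots_power2)
qed

lemma num_square_roots_eq_0_iff: "num_square_roots a = 0 \<longleftrightarrow> (\<nexists>u. u ^ 2 = a)"
  by (simp add: num_square_roots_def)

lemma quadratic_char_eq_1_iff: "quadratic_char x = 1 \<longleftrightarrow> x \<noteq> 0 \<and> (\<exists>u. u ^ 2 = x)"
  by (simp add: quadratic_char_def)

lemma quadratic_char_eq_minus_1_iff: "quadratic_char x = -1 \<longleftrightarrow> x \<noteq> 0 \<and> (\<nexists>u. u ^ 2 = x)"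
  by (simp add: quadratic_char_def)

section \<open>Bordered matrices\<close>

definition bordered_mat :: "'a :: zero mat \<Rightarrow> 'a mat \<Rightarrow> 'a \<Rightarrow> 'a mat" where
  "bordered_mat V w x = four_block_mat V w (0\<^sub>m 1 (dim_col V)) (mat 1 1 (\<lambda>_. x))"

lemma four_block_mat_inject:
  assumes "A \<in> carrier_mat n m" "B \<in> carrier_mat n m'" "C \<in> carrier_mat n' m" "D \<in> carrier_mat n' m'"
    and "A' \<in> carrier_mat n m" "B' \<in> carrier_mat n m'" "C' \<in> carrier_mat n' m" "D' \<in> carrier_mat n' m'"
  shows "four_block_mat A B C D = four_block_mat A' B' C' D' \<longleftrightarrow>
    A = A' \<and> B = B' \<and> C = C' \<and> D = D'" (is "?F = ?F' \<longleftrightarrow> _")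
proof
  assume eq: "?F = ?F'"
  have entry: "?F $$ (i, j) = ?F' $$ (i, j)" for i j
    by (simp add: eq)
  have "A = A'"
  proof (rule eq_matI)
    fix i j assume "i < dim_row A'" "j < dim_col A'"
    then show "A $$ (i, j) = A' $$ (i, j)"
      using entry[of i j] assms by auto
  qed (use assms in auto)
  moreover have "B = B'"
  proof (rule eq_matI)
    fix i j assume "i < dim_row B'" "j < dim_col B'"
    then show "B $$ (i, j) = B' $$ (i, j)"
      using entry[of i "m + j"] assms by auto
  qed (use assms in auto)
  moreover have "C = C'"
  proof (rule eq_matI)
    fix i j assume "i < dim_row C'" "j < dim_col C'"
    then show "C $$ (i, j) = C' $$ (i, j)"
      using entry[of "n + i" j] assms by auto
  qed (use assms in auto)
  moreover have "D = D'"
  proof (rule eq_matI)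
    fix i j assume "i < dim_row D'" "j < dim_col D'"
    then show "D $$ (i, j) = D' $$ (i, j)"
      using entry[of "n + i" "m + j"] assms by auto
  qed (use assms in auto)
  ultimately show "A = A' \<and> B = B' \<and> C = C' \<and> D = D'"
    by simp
qed simp

lemma bordered_mat_carrier [simp]:
  assumes "V \<in> carrier_mat n n"
  shows "bordered_mat V w x \<in> carrier_mat (Suc n) (Suc n)"
  using assms unfolding bordered_mat_def by auto

lemma upper_triangular_bordered_mat_iff:
  assumes "V \<in> carrier_mat n n" and "w \<in> carrier_mat n 1"
  shows "upper_triangular (bordered_mat V w x) \<longleftrightarrow> upper_triangular V"
proof
  assume U: "upper_triangular (bordered_mat V w x)"
  show "upper_triangular V"
  proof
    fix i j assume "j < i" "i < dim_row V"
    then show "V $$ (i, j) = 0"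
      using upper_triangularD[OF U, of j i] assms by (auto simp: bordered_mat_def)
  qed
next
  assume V: "upper_triangular V"
  show "upper_triangular (bordered_mat V w x)"
    using assms upper_triangularD[OF V]
    by (intro upper_triangularI) (auto simp: bordered_mat_def)
qed

text \<open>The last row of an upper triangular matrix vanishes off the diagonal.\<close>
lemma upper_triangular_bordered_mat_cases:
  assumes "U \<in> carrier_mat (Suc n) (Suc n)" and "upper_triangular U"
  obtains V w x where "V \<in> carrier_mat n n" "w \<in> carrier_mat n 1" "U = bordered_mat V w x"
proof
  let ?V = "mat n n (\<lambda>(i, j). U $$ (i, j))"
  let ?w = "mat n 1 (\<lambda>(i, j). U $$ (i, n))"
  show "?V \<in> carrier_mat n n" "?w \<in> carrier_mat n 1"
    by simp_all
  show "U = bordered_mat ?V ?w (U $$ (n, n))"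
    by (rule eq_matI)
      (use assms upper_triangularD[OF assms(2)] in \<open>auto simp: bordered_mat_def less_Suc_eq\<close>)
qed

lemma bordered_mat_gram:
  fixes V :: "'a :: comm_ring_1 mat"
  assumes V: "V \<in> carrier_mat n n" and w: "w \<in> carrier_mat n 1"
  shows "transpose_mat (bordered_mat V w x) * bordered_mat V w x =
    four_block_mat (transpose_mat V * V) (transpose_mat V * w) (transpose_mat w * V)
      (transpose_mat w * w + mat 1 1 (\<lambda>_. x ^ 2))"
proof -
  have 1: "transpose_mat (mat 1 1 (\<lambda>_. x)) * mat 1 1 (\<lambda>_. x) = mat 1 1 (\<lambda>_. x ^ 2)"
    by (rule eq_matI) (auto simp: scalar_prod_def power2_eq_square)
  have 2: "transpose_mat (bordered_mat V w x) =
      four_block_mat (transpose_mat V) (0\<^sub>m n 1) (transpose_mat w) (transpose_mat (mat 1 1 (\<lambda>_. x)))"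
    unfolding bordered_mat_def
    by (subst transpose_four_block_mat[of _ n n _ 1 _ 1]) (use V w in auto)
  show ?thesis
    unfolding 2 unfolding bordered_mat_def
    by (subst mult_four_block_mat[of _ n n _ 1 _ 1 _ _ n _ 1]) (use V w 1 in auto)
qed

text \<open>
  One step of block elimination: the matrix on the left is
  \<open>(V\<^sup>T, 0; w\<^sup>T, 1) (V, w; 0, C - w\<^sup>T w)\<close>, and both factors are block triangular.
\<close>
lemma det_bordered_gram:
  fixes V :: "'a :: idom mat"
  assumes V: "V \<in> carrier_mat n n" and w: "w \<in> carrier_mat n 1" and C: "C \<in> carrier_mat 1 1"
  shows "det (four_block_mat (transpose_mat V * V) (transpose_mat V * w) (transpose_mat w * V) C) =
    det (transpose_mat V * V) * (C $$ (0, 0) - (transpose_mat w * w) $$ (0, 0))"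
proof -
  let ?L = "four_block_mat (transpose_mat V) (0\<^sub>m n 1) (transpose_mat w) (1\<^sub>m 1)"
  let ?s = "C - transpose_mat w * w"
  let ?R = "four_block_mat V w (0\<^sub>m 1 n) ?s"
  have "transpose_mat w * w + ?s = C"
    by (rule eq_matI) (use w C in auto)
  then have "four_block_mat (transpose_mat V * V) (transpose_mat V * w) (transpose_mat w * V) C = ?L * ?R"
    by (subst mult_four_block_mat[of _ n n _ 1 _ 1 _ _ n _ 1]) (use V w C in auto)
  moreover have "det (?L * ?R) = det ?L * det ?R"
    by (rule det_mult[of _ "n + 1"]; rule four_block_carrier_mat) (use V w C in auto)
  moreover have "det ?L = det (transpose_mat V) * det (1\<^sub>m 1)"
    by (rule det_four_block_mat_upper_right_zero[of _ n _ 1]) (use V w in auto)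
  moreover have "det ?R = det V * det ?s"
    by (rule det_four_block_mat_lower_left_zero[of _ n _ 1]) (use V w C in auto)
  moreover have "det ?s = C $$ (0, 0) - (transpose_mat w * w) $$ (0, 0)"
    by (subst det_single) (use w C in auto)
  moreover have "det (transpose_mat V * V) = det (transpose_mat V) * det V"
    by (rule det_mult[of _ n]) (use V in auto)
  ultimately show ?thesis
    by simp
qed

section \<open>Counting upper triangular factors\<close>

definition upper_factors :: "nat \<Rightarrow> 'a :: semiring_0 mat \<Rightarrow> 'a mat set" where
  "upper_factors n A = {U \<in> carrier_mat n n. upper_triangular U \<and> transpose_mat U * U = A}"

lemma ex1_solution_transpose:
  fixes V :: "'a :: field mat"
  assumes V: "V \<in> carrier_mat n n" and "det V \<noteq> 0" and b: "b \<in> carrier_mat n m"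
  shows "\<exists>!w. w \<in> carrier_mat n m \<and> transpose_mat V * w = b"
proof -
  have T: "transpose_mat V \<in> carrier_mat n n"
    using V by simp
  have "det (transpose_mat V) \<noteq> 0"
    using assms by (simp add: det_transpose[OF V])
  from det_non_zero_imp_unit[OF T this, of "()"]
  obtain P where P: "P \<in> carrier_mat n n" "P * transpose_mat V = 1\<^sub>m n" "transpose_mat V * P = 1\<^sub>m n"
    by (auto simp: Units_def ring_mat_def)
  show ?thesis
  proof (rule ex1I[of _ "P * b"])
    show "P * b \<in> carrier_mat n m \<and> transpose_mat V * (P * b) = b"
      using P b assoc_mult_mat[OF T P(1) b] by simp
  next
    fix w assume "w \<in> carrier_mat n m \<and> transpose_mat V * w = b"
    then show "w = P * b"
      using P assoc_mult_mat[OF P(1) T, of w m] by auto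
  qed
qed

lemma det_upper_factor_nonzero:
  fixes B :: "'a :: idom mat"
  assumes "V \<in> upper_factors n B" and "det B \<noteq> 0"
  shows "det V \<noteq> 0"
proof -
  have V: "V \<in> carrier_mat n n" and B: "transpose_mat V * V = B"
    using assms(1) by (auto simp: upper_factors_def)
  have "det B = det (transpose_mat V) * det V"
    unfolding B[symmetric] by (rule det_mult[of _ n]) (use V in auto)
  then show ?thesis
    using assms(2) by auto
qed

text \<open>
  Of the four block equations, the lower left one is the transpose of the upper right one, and the
  scalar one becomes the condition on \<open>x\<^sup>2\<close> because \<open>det_bordered_gram\<close> identifies
  \<open>C - w\<^sup>T w\<close> with the quotient of determinants.
\<close>
lemma bordered_mat_mem_upper_factors_iff:
  fixes B :: "'a :: field mat"
  assumes B: "B \<in> carrier_mat n n" "det B \<noteq> 0" and b: "b \<in> carrier_mat n 1"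
    and C: "C \<in> carrier_mat 1 1"
    and V: "V \<in> carrier_mat n n" and w: "w \<in> carrier_mat n 1"
  defines "A \<equiv> four_block_mat B b (transpose_mat b) C"
  shows "bordered_mat V w x \<in> upper_factors (Suc n) A \<longleftrightarrow>
    V \<in> upper_factors n B \<and> transpose_mat V * w = b \<and> x ^ 2 = det A / det B"
proof -
  have *: "transpose_mat (bordered_mat V w x) * bordered_mat V w x = A \<longleftrightarrow>
      transpose_mat V * V = B \<and> transpose_mat V * w = b \<and> transpose_mat w * V = transpose_mat b \<and>
      transpose_mat w * w + mat 1 1 (\<lambda>_. x ^ 2) = C"
    unfolding bordered_mat_gram[OF V w] A_def
    by (rule four_block_mat_inject[of _ n n _ 1 _ 1]) (use B b C V w in auto)
  have corner: "transpose_mat w * V = transpose_mat b \<and> transpose_mat w * w + mat 1 1 (\<lambda>_. x ^ 2) = C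
      \<longleftrightarrow> x ^ 2 = det A / det B"
    if BV: "transpose_mat V * V = B" and bw: "transpose_mat V * w = b"
  proof -
    have bt: "transpose_mat w * V = transpose_mat b"
      unfolding bw[symmetric] by (subst transpose_mult[of _ n n _ 1]) (use V w in auto)
    have "det A = det B * (C $$ (0, 0) - (transpose_mat w * w) $$ (0, 0))"
      using det_bordered_gram[OF V w C] unfolding BV bw bt A_def .
    then have d: "det A / det B = C $$ (0, 0) - (transpose_mat w * w) $$ (0, 0)"
      using B by simp
    have entry: "transpose_mat w * w + mat 1 1 (\<lambda>_. x ^ 2) = C \<longleftrightarrow>
        (transpose_mat w * w) $$ (0, 0) + x ^ 2 = C $$ (0, 0)"
    proof
      assume "transpose_mat w * w + mat 1 1 (\<lambda>_. x ^ 2) = C"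
      then have "(transpose_mat w * w + mat 1 1 (\<lambda>_. x ^ 2)) $$ (0, 0) = C $$ (0, 0)"
        by simp
      then show "(transpose_mat w * w) $$ (0, 0) + x ^ 2 = C $$ (0, 0)"
        by simp
    next
      assume "(transpose_mat w * w) $$ (0, 0) + x ^ 2 = C $$ (0, 0)"
      then show "transpose_mat w * w + mat 1 1 (\<lambda>_. x ^ 2) = C"
        by (intro eq_matI) (use w C in auto)
    qed
    show ?thesis
      unfolding entry d eq_diff_eq by (simp only: bt add.commute simp_thms)
  qed
  have "transpose_mat (bordered_mat V w x) * bordered_mat V w x = A \<longleftrightarrow>
      transpose_mat V * V = B \<and> transpose_mat V * w = b \<and> x ^ 2 = det A / det B"
    unfolding * by (intro conj_cong refl corner) assumption+
  then show ?thesis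
    using V by (simp add: upper_factors_def upper_triangular_bordered_mat_iff[OF V w])
qed

text \<open>
  The last column above the diagonal is determined by \<open>V\<close>, so \<open>V\<close> and the corner entry \<open>x\<close>
  parametrize the factors of the bordered matrix. The condition on \<open>x\<close> does not involve \<open>V\<close>, which
  makes the set of parameters a product.
\<close>
lemma card_upper_factors_bordered:
  fixes B :: "'a :: {field, finite} mat"
  assumes B: "B \<in> carrier_mat n n" "det B \<noteq> 0" and b: "b \<in> carrier_mat n 1"
    and C: "C \<in> carrier_mat 1 1"
  defines "A \<equiv> four_block_mat B b (transpose_mat b) C"
  shows "card (upper_factors (Suc n) A) =
    card (upper_factors n B) * num_square_roots (det A / det B)"
proof -
  \<comment> \<open>meaningful for factors \<open>V\<close> of \<open>B\<close> only: the column \<open>b\<close> multiplied from the left by the inverse of \<open>V\<^sup>T\<close>\<close>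
  define w where "w V = (THE w. w \<in> carrier_mat n 1 \<and> transpose_mat V * w = b)" for V
  let ?R = "{x. x ^ 2 = det A / det B}"
  note mem_iff = bordered_mat_mem_upper_factors_iff[OF B b C, folded A_def]
  have w_unique: "\<exists>!w. w \<in> carrier_mat n 1 \<and> transpose_mat V * w = b"
    if "V \<in> upper_factors n B" for V
    by (rule ex1_solution_transpose)
      (use that det_upper_factor_nonzero[OF that B(2)] b in \<open>auto simp: upper_factors_def\<close>)
  have w: "w V \<in> carrier_mat n 1" "transpose_mat V * w V = b" if "V \<in> upper_factors n B" for V
    using theI'[OF w_unique[OF that]] by (auto simp: w_def)
  have carrier: "V \<in> carrier_mat n n" if "V \<in> upper_factors n B" for V
    using that by (simp add: upper_factors_def)
  have "bij_betw (\<lambda>(V, x). bordered_mat V (w V) x) (upper_factors n B \<times> ?R) (upper_factors (Suc n) A)"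
  proof (rule bij_betw_imageI)
    show "inj_on (\<lambda>(V, x). bordered_mat V (w V) x) (upper_factors n B \<times> ?R)"
    proof (rule inj_onI, clarify)
      fix V V' :: "'a mat" and x x' :: 'a
      assume V: "V \<in> upper_factors n B" "V' \<in> upper_factors n B"
        and "bordered_mat V (w V) x = bordered_mat V' (w V') x'"
      then have eq: "V = V' \<and> mat 1 1 (\<lambda>_. x) = mat 1 1 (\<lambda>_. x')"
        using carrier[OF V(1)] carrier[OF V(2)] w[OF V(1)] w[OF V(2)]
        unfolding bordered_mat_def
        by (subst (asm) four_block_mat_inject[of _ n n _ 1 _ 1]) auto
      have "mat 1 1 (\<lambda>_. x) $$ (0, 0) = mat 1 1 (\<lambda>_. x') $$ (0, 0)"
        by (simp only: eq)
      then have "x = x'"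
        by simp
      with eq show "V = V' \<and> x = x'"
        by simp
    qed
    show "(\<lambda>(V, x). bordered_mat V (w V) x) ` (upper_factors n B \<times> ?R) = upper_factors (Suc n) A"
    proof (intro equalityI subsetI)
      fix U assume "U \<in> (\<lambda>(V, x). bordered_mat V (w V) x) ` (upper_factors n B \<times> ?R)"
      then show "U \<in> upper_factors (Suc n) A"
        using w carrier mem_iff by auto
    next
      fix U assume U: "U \<in> upper_factors (Suc n) A"
      then obtain V w' x where V: "V \<in> carrier_mat n n" "w' \<in> carrier_mat n 1"
        and eq: "U = bordered_mat V w' x"
        by (auto simp: upper_factors_def elim: upper_triangular_bordered_mat_cases)
      then have *: "V \<in> upper_factors n B" "transpose_mat V * w' = b" "x \<in> ?R"
        using U mem_iff[OF V] by auto
      then have "w' = w V"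
        using V w_unique w by blast
      then show "U \<in> (\<lambda>(V, x). bordered_mat V (w V) x) ` (upper_factors n B \<times> ?R)"
        using * eq by (auto intro!: image_eqI[of _ _ "(V, x)"])
    qed
  qed
  then have "card (upper_factors (Suc n) A) = card (upper_factors n B \<times> ?R)"
    by (simp add: bij_betw_same_card)
  then show ?thesis
    by (simp add: card_cartesian_product num_square_roots_def)
qed

lemma leading_minor_carrier:
  assumes "A \<in> carrier_mat n n"
  shows "leading_minor n A = det A"
proof -
  have "mat n n (\<lambda>(i, j). A $$ (i, j)) = A"
    by (rule eq_matI) (use assms in auto)
  then show ?thesis
    by (simp add: leading_minor_eq_det_mat[OF assms])
qed

lemma leading_minor_truncate:
  assumes "A \<in> carrier_mat m m" and "n \<le> m" and "k \<le> n"
  shows "leading_minor k (mat n n (\<lambda>(i, j). A $$ (i, j))) = leading_minor k A"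
proof -
  have "mat k k (\<lambda>(i, j). mat n n (\<lambda>(i, j). A $$ (i, j)) $$ (i, j)) = mat k k (\<lambda>(i, j). A $$ (i, j))"
    by (rule eq_matI) (use assms in auto)
  then show ?thesis
    using assms by (simp add: leading_minor_eq_det_mat[of A m] leading_minor_eq_det_mat[of _ n])
qed

text \<open>
  The leading block inherits symmetry and its leading minors from \<open>A\<close>. Symmetry of \<open>A\<close> supplies
  the bordered form with \<open>b\<^sup>T\<close> below \<open>B\<close>, and the minor of size \<open>n\<close> is \<open>det B\<close>.
\<close>
lemma card_upper_factors_eq_prod:
  fixes A :: "'a :: {field, finite} mat"
  assumes "A \<in> carrier_mat n n" and "symmetric_mat A"
    and "\<And>k. k \<in> {1..n} \<Longrightarrow> leading_minor k A \<noteq> 0"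
  shows "card (upper_factors n A) = (\<Prod>k=1..n. num_square_roots (leading_minor_ratio k A))"
  using assms
proof (induction n arbitrary: A)
  case 0
  have "upper_factors 0 A = {A}"
  proof -
    have "U = A" if "U \<in> carrier_mat 0 0" for U
      by (rule eq_matI) (use that 0 in auto)
    moreover have "transpose_mat A * A = A"
      by (rule eq_matI) (use 0 in auto)
    moreover have "upper_triangular A"
      using 0(1) by (intro upper_triangularI) simp
    ultimately show ?thesis
      using 0(1) unfolding upper_factors_def by blast
  qed
  then show ?case
    by simp
next
  case (Suc n)
  define B where "B = mat n n (\<lambda>(i, j). A $$ (i, j))"
  define b where "b = mat n 1 (\<lambda>(i, j). A $$ (i, n))"
  define C where "C = mat 1 1 (\<lambda>_. A $$ (n, n))"
  have sym: "A $$ (i, j) = A $$ (j, i)" if "i < Suc n" "j < Suc n" for i j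
    using that Suc.prems(1,2) unfolding symmetric_mat_def
    by (metis carrier_matD index_transpose_mat(1))
  have carrier: "B \<in> carrier_mat n n" "b \<in> carrier_mat n 1" "C \<in> carrier_mat 1 1"
    by (simp_all add: B_def b_def C_def)
  have A_blocks: "A = four_block_mat B b (transpose_mat b) C"
  proof (rule eq_matI)
    fix i j
    assume "i < dim_row (four_block_mat B b (transpose_mat b) C)"
      and "j < dim_col (four_block_mat B b (transpose_mat b) C)"
    then have ij: "i < Suc n" "j < Suc n"
      using carrier by auto
    then show "A $$ (i, j) = four_block_mat B b (transpose_mat b) C $$ (i, j)"
      using sym[of i j] by (cases "i = n"; cases "j = n") (simp_all add: B_def b_def C_def)
  qed (use Suc.prems(1) carrier in auto)
  \<comment> \<open>\<open>k = 0\<close> is included, since the ratio for \<open>k = 1\<close> has the empty minor as denominator\<close>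
  have minor_B: "leading_minor k B = leading_minor k A" if "k \<le> n" for k
    unfolding B_def by (rule leading_minor_truncate[OF Suc.prems(1)]) (use that in auto)
  have det_B: "det B = leading_minor n A"
    using minor_B[of n] leading_minor_carrier[OF carrier(1)] by simp
  have det_B_nonzero: "det B \<noteq> 0"
    using Suc.prems(3)[of n] by (cases "n = 0") (auto simp: det_B leading_minor_0)
  have "symmetric_mat B"
    unfolding symmetric_mat_def by (rule eq_matI) (simp_all add: B_def sym[OF less_SucI less_SucI])
  then have IH: "card (upper_factors n B) = (\<Prod>k=1..n. num_square_roots (leading_minor_ratio k B))"
    by (rule Suc.IH[OF carrier(1)]) (use Suc.prems(3) minor_B in auto)
  have "leading_minor_ratio (Suc n) A = det A / det B"
    by (simp add: leading_minor_ratio_def det_B leading_minor_carrier[OF Suc.prems(1)])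
  moreover have "leading_minor_ratio k B = leading_minor_ratio k A" if "k \<in> {1..n}" for k
  proof -
    have "k \<le> n" "k - 1 \<le> n"
      using that by auto
    then show ?thesis
      by (simp only: leading_minor_ratio_def minor_B)
  qed
  ultimately show ?case
    using card_upper_factors_bordered[OF carrier(1) det_B_nonzero carrier(2,3), folded A_blocks] IH
    by simp
qed

text \<open>The leading minor of size \<open>k\<close> is the product of the first \<open>k\<close> ratios.\<close>
lemma ex_sqrt_leading_minor:
  fixes A :: "'a :: field mat"
  assumes "\<And>k. k \<in> {1..n} \<Longrightarrow> leading_minor k A \<noteq> 0"
    and "\<And>k. k \<in> {1..n} \<Longrightarrow> \<exists>u. u ^ 2 = leading_minor_ratio k A"
    and "k \<le> n"
  shows "\<exists>u. u ^ 2 = leading_minor k A"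
  using assms(3)
proof (induction k)
  case 0
  show ?case
    by (rule exI[of _ 1]) (simp add: leading_minor_0)
next
  case (Suc k)
  then obtain u v where uv: "u ^ 2 = leading_minor k A" "v ^ 2 = leading_minor_ratio (Suc k) A"
    using assms(2)[of "Suc k"] by auto
  have "leading_minor k A \<noteq> 0"
    using assms(1)[of k] Suc.prems by (cases "k = 0") (auto simp: leading_minor_0)
  then have "(u * v) ^ 2 = leading_minor (Suc k) A"
    by (simp add: power_mult_distrib uv leading_minor_ratio_def)
  then show ?case
    by blast
qed

theorem corollary3p4:
  fixes A :: "'a :: {field, finite} mat" and n :: nat
  assumes "n \<ge> 1"
    and "A \<in> carrier_mat n n"
    and "symmetric_mat A"
    and "lpm_mat A"
  shows "num_upper_factorizations A = (\<Prod>k=1..n. num_square_roots (leading_minor_ratio k A))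
    \<and> (even CARD('a) \<longrightarrow> num_upper_factorizations A = 1)
    \<and> (odd CARD('a) \<and> (\<forall>k\<in>{1..n}. quadratic_char (leading_minor k A) = 1)
         \<longrightarrow> num_upper_factorizations A = 2 ^ n)
    \<and> (odd CARD('a) \<and> (\<exists>k\<in>{1..n}. quadratic_char (leading_minor k A) = -1)
         \<longrightarrow> num_upper_factorizations A = 0)"
proof -
  have minor: "leading_minor k A \<noteq> 0" if "k \<in> {1..n}" for k
    using that assms(2,4) by (auto simp: lpm_mat_def)
  have count: "num_upper_factorizations A = (\<Prod>k=1..n. num_square_roots (leading_minor_ratio k A))"
    using card_upper_factors_eq_prod[OF assms(2,3) minor] assms(2)
    by (simp add: num_upper_factorizations_def upper_factors_def)
  have even_case: "num_upper_factorizations A = 1" if "even CARD('a)"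
    by (simp add: count num_square_roots_even_card[OF that])
  have residue_case: "num_upper_factorizations A = 2 ^ n"
    if odd: "odd CARD('a)" and char: "\<forall>k\<in>{1..n}. quadratic_char (leading_minor k A) = 1"
  proof -
    have root: "\<exists>u. u \<noteq> 0 \<and> u ^ 2 = leading_minor k A" if "k \<le> n" for k
    proof (cases "k = 0")
      case True
      then show ?thesis
        by (intro exI[of _ 1]) (simp add: leading_minor_0)
    next
      case False
      then have "quadratic_char (leading_minor k A) = 1"
        using char that by auto
      then show ?thesis
        unfolding quadratic_char_eq_1_iff by (metis zero_power2)
    qed
    have "num_square_roots (leading_minor_ratio k A) = 2" if k: "k \<in> {1..n}" for k
    proof -
      obtain u where u: "u \<noteq> 0" "u ^ 2 = leading_minor k A"
        using root[of k] k by auto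
      obtain v where v: "v \<noteq> 0" "v ^ 2 = leading_minor (k - 1) A"
        using root[of "k - 1"] k by (meson atLeastAtMost_iff diff_le_self le_trans)
      have "leading_minor_ratio k A = (u / v) ^ 2"
        by (simp add: leading_minor_ratio_def power_divide u v)
      then show ?thesis
        using num_square_roots_odd_card[OF odd, of "u / v"] u v by simp
    qed
    then show ?thesis
      by (simp add: count)
  qed
  have nonresidue_case: "num_upper_factorizations A = 0"
    if "\<exists>k\<in>{1..n}. quadratic_char (leading_minor k A) = -1"
  proof (rule ccontr)
    assume "num_upper_factorizations A \<noteq> 0"
    then have ratio: "\<exists>u. u ^ 2 = leading_minor_ratio k A" if "k \<in> {1..n}" for k
      using that by (auto simp: count num_square_roots_eq_0_iff)
    obtain k where k: "k \<in> {1..n}" "quadratic_char (leading_minor k A) = -1"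
      using \<open>\<exists>k\<in>{1..n}. quadratic_char (leading_minor k A) = -1\<close> by blast
    then have "\<exists>u. u ^ 2 = leading_minor k A"
      by (intro ex_sqrt_leading_minor[OF minor ratio]) auto
    with k(2) show False
      by (simp add: quadratic_char_eq_minus_1_iff)
  qed
  show ?thesis
    by (intro conjI impI; (elim conjE)?)
      (rule count, erule even_case, erule (1) residue_case, erule nonresidue_case)
qed

end
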